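(* The total dominating set problem is solvable in polynomial time for total domishold graphs; that is, there is a polynomial time algorithm that, given a total domishold graph $G$ without isolated vertices, computes its total domination number $\gamma_t(G)$.
   Context: Graphs are finite, simple and undirected. A total dominating set in $G=(V,E)$ is a set $D\subseteq V$ such that every vertex of $G$ has a neighbor in $D$. The total domination number $\gamma_t(G)$ of a graph $G$ without isolated vertices is the minimum size of a total dominating set in $G$; the total dominating set problem is the problem of computing $\gamma_t(G)$ for a given graph $G$ without isolated vertices. $G$ is total domishold if there exist $w:V\to\mathbb{R}_+$ and $t\in\mathbb{R}_+$ (non-negative reals) such that for every $S\subseteq V$, $\sum_{x\in S}w(x)\ge t$ if and only if $S$ is a total dominating set in $G$. The pair $(w,t)$ is not part of the input. *)

theory Defs
  imports "Graph_Theory.Pair_Digraph" "HOL-Computational_Algebra.Polynomial"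
begin

section \<open>Total domination\<close>

text \<open>
  A finite simple undirected graph is a \<^locale>\<open>pair_graph\<close>: finitely many vertices, a symmetric
  set of arcs, no loops. Two vertices \<open>u\<close>, \<open>v\<close> are adjacent iff \<open>(u, v) \<in> parcs G\<close>.
\<close>

definition no_isolated_vertices :: "'a pair_pre_digraph \<Rightarrow> bool" where
  "no_isolated_vertices G \<longleftrightarrow> (\<forall>v \<in> pverts G. \<exists>u \<in> pverts G. (v, u) \<in> parcs G)"

definition total_dominating_set :: "'a pair_pre_digraph \<Rightarrow> 'a set \<Rightarrow> bool" where
  "total_dominating_set G D \<longleftrightarrow>
     D \<subseteq> pverts G \<and> (\<forall>v \<in> pverts G. \<exists>u \<in> D. (v, u) \<in> parcs G)"

definition total_domination_number :: "'a pair_pre_digraph \<Rightarrow> nat" where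
  "total_domination_number G = (LEAST k. \<exists>D. total_dominating_set G D \<and> card D = k)"

definition total_domishold :: "'a pair_pre_digraph \<Rightarrow> bool" where
  "total_domishold G \<longleftrightarrow>
     (\<exists>(w :: 'a \<Rightarrow> real) (t :: real).
        (\<forall>v \<in> pverts G. w v \<ge> 0) \<and> t \<ge> 0 \<and>
        (\<forall>S \<subseteq> pverts G. (\<Sum>x \<in> S. w x) \<ge> t \<longleftrightarrow> total_dominating_set G S))"


section \<open>Polynomial-time computability\<close>

text \<open>
  The machine model is the random access machine with a read-only input of bits, registers
  \<open>0, 1, 2, \<dots>\<close> holding natural numbers, indirect addressing, and addition and truncated subtraction
  as its only arithmetic, programmed with structured control flow. Every elementary
  instruction and every test costs one step. As there is no multiplication, \<open>t\<close> steps
  produce only numbers of \<open>O(t)\<close> bits, so polynomial time on this machine is the same as polynomial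
  time on a Turing machine.
\<close>

datatype com =
    Skip
  | Const nat nat       \<comment> \<open>\<open>Const r k\<close>: \<open>R[r] := k\<close>\<close>
  | Add nat nat nat     \<comment> \<open>\<open>Add r a b\<close>: \<open>R[r] := R[a] + R[b]\<close>\<close>
  | Sub nat nat nat     \<comment> \<open>\<open>Sub r a b\<close>: \<open>R[r] := max 0 (R[a] - R[b])\<close>\<close>
  | Load nat nat        \<comment> \<open>\<open>Load r a\<close>: \<open>R[r] := R[R[a]]\<close>\<close>
  | Store nat nat       \<comment> \<open>\<open>Store a b\<close>: \<open>R[R[a]] := R[b]\<close>\<close>
  | Read nat nat        \<comment> \<open>\<open>Read r a\<close>: \<open>R[r] :=\<close> input symbol at position \<open>R[a]\<close>\<close>
  | Seq com com
  | Cond nat com com    \<comment> \<open>\<open>Cond r c d\<close>: if \<open>R[r] \<noteq> 0\<close> then \<open>c\<close> else \<open>d\<close>\<close>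
  | While nat com       \<comment> \<open>\<open>While r c\<close>: while \<open>R[r] \<noteq> 0\<close> do \<open>c\<close>\<close>

text \<open>The value 2 marks positions beyond the end of the input.\<close>

definition input_symbol :: "bool list \<Rightarrow> nat \<Rightarrow> nat" where
  "input_symbol x i = (if i < length x then of_bool (x ! i) else 2)"

text \<open>
  \<open>exec x c s t s'\<close>: on input \<open>x\<close>, program \<open>c\<close> started with register contents \<open>s\<close> halts after
  exactly \<open>t\<close> steps with register contents \<open>s'\<close>.
\<close>

inductive exec ::
  "bool list \<Rightarrow> com \<Rightarrow> (nat \<Rightarrow> nat) \<Rightarrow> nat \<Rightarrow> (nat \<Rightarrow> nat) \<Rightarrow> bool" for x :: "bool list"
where
  Skip: "exec x Skip s 1 s"
| Const: "exec x (Const r k) s 1 (s(r := k))"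
| Add: "exec x (Add r a b) s 1 (s(r := s a + s b))"
| Sub: "exec x (Sub r a b) s 1 (s(r := s a - s b))"
| Load: "exec x (Load r a) s 1 (s(r := s (s a)))"
| Store: "exec x (Store a b) s 1 (s(s a := s b))"
| Read: "exec x (Read r a) s 1 (s(r := input_symbol x (s a)))"
| Seq: "exec x c s t s' \<Longrightarrow> exec x d s' t' s'' \<Longrightarrow> exec x (Seq c d) s (t + t') s''"
| CondTrue: "s r \<noteq> 0 \<Longrightarrow> exec x c s t s' \<Longrightarrow> exec x (Cond r c d) s (t + 1) s'"
| CondFalse: "s r = 0 \<Longrightarrow> exec x d s t s' \<Longrightarrow> exec x (Cond r c d) s (t + 1) s'"
| WhileFalse: "s r = 0 \<Longrightarrow> exec x (While r c) s 1 s"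
| WhileTrue: "s r \<noteq> 0 \<Longrightarrow> exec x c s t s' \<Longrightarrow> exec x (While r c) s' t' s'' \<Longrightarrow>
    exec x (While r c) s (t + t' + 1) s''"


lemma exec_deterministic:
  "exec x c s t s' \<Longrightarrow> exec x c s u s'' \<Longrightarrow> t = u \<and> s' = s''"
proof (induction arbitrary: u s'' rule: exec.induct)
  case (Seq c s t s' d t' s1)
  from Seq.prems show ?case
    by cases (auto dest!: Seq.IH)
next
  case (CondTrue s r c t s' d)
  from CondTrue.prems CondTrue.hyps show ?case
    by cases (auto dest!: CondTrue.IH)
next
  case (CondFalse s r d t s' c)
  from CondFalse.prems CondFalse.hyps show ?case
    by cases (auto dest!: CondFalse.IH)
next
  case (WhileTrue s r c t s' t' s1)
  from WhileTrue.prems WhileTrue.hyps show ?case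
    by cases (auto dest!: WhileTrue.IH)
qed (erule exec.cases; simp; fail)+

text \<open>
  A computational problem is given by its set of instances, their binary encoding, and the
  value to be computed, which is returned in register 0; initially all registers are 0. Nothing
  is required of the program on strings that do not encode an instance.
\<close>

definition poly_time_computable :: "'i set \<Rightarrow> ('i \<Rightarrow> bool list) \<Rightarrow> ('i \<Rightarrow> nat) \<Rightarrow> bool" where
  "poly_time_computable inst enc f \<longleftrightarrow>
     (\<exists>(c :: com) (p :: nat poly). \<forall>i \<in> inst. \<exists>t s.
        exec (enc i) c (\<lambda>_. 0) t s \<and> t \<le> poly p (length (enc i)) \<and> s 0 = f i)"


section \<open>Graphs as input\<close>

text \<open>
  A graph is presented through an arbitrary enumeration \<open>vs\<close> of its vertices, as the number
  of vertices in unary, a separator, and the adjacency matrix row by row. The names of the vertices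
  are not visible in the encoding.
\<close>

definition graph_code :: "'a pair_pre_digraph \<Rightarrow> 'a list \<Rightarrow> bool list" where
  "graph_code G vs =
     replicate (length vs) True @ [False] @
     concat (map (\<lambda>u. map (\<lambda>v. (u, v) \<in> parcs G) vs) vs)"

definition vertex_enumeration :: "'a pair_pre_digraph \<Rightarrow> 'a list \<Rightarrow> bool" where
  "vertex_enumeration G vs \<longleftrightarrow> distinct vs \<and> set vs = pverts G"

end

theory Submission
  imports Defs
begin

text \<open>
  The total dominating sets of a graph are the transversals of its neighbourhood hypergraph. If
  weights decide which sets are transversals, then a heavy vertex can replace a light one in any
  transversal, so some minimum transversal consists of the heaviest vertices, and the minimum size
  is the length of the shortest initial segment, in the order of decreasing weight, that is a
  transversal.

  The weights are not given, but only the order matters, and a sufficient substitute for it can be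
  read off the edges: every transversal containing \<open>v\<close> but not \<open>u\<close> stays one when \<open>v\<close> is replaced
  by \<open>u\<close> iff for every edge \<open>C\<close> through \<open>v\<close> that avoids \<open>u\<close>, some edge lies in
  \<open>insert u (C - {v})\<close>. This relation \<open>outranks\<close> is a preorder, the weights make it
  total, and ties are broken by the enumeration of the vertices. Since an initial segment is a
  transversal exactly when it has at least as many elements as a minimum transversal, the minimum
  is the number of vertices whose strict predecessors do not form a transversal
  (\<open>minimum_transversal_threshold\<close>).

  This number is built from the adjacency matrix by a fixed nesting of quantifiers and one count, all
  of which range over the \<open>n\<close> vertices; no data have to be stored between iterations. It is
  therefore the value of an expression made of sums over \<open>j < n\<close>, sums and differences, and
  accesses to the input. Such an expression compiles to nested loops, with one factor \<open>n\<close> of running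
  time for each level of summation (\<open>exec_compile\<close>). The order \<open>n\<close> itself is found by scanning
  the unary prefix of the encoding.
\<close>

section \<open>Minimum transversals of threshold hypergraphs\<close>

definition transversal :: "'a set set \<Rightarrow> 'a set \<Rightarrow> bool" where
  "transversal H S \<longleftrightarrow> (\<forall>C\<in>H. C \<inter> S \<noteq> {})"

definition outranks :: "'a set set \<Rightarrow> 'a \<Rightarrow> 'a \<Rightarrow> bool" where
  "outranks H u v \<longleftrightarrow> (\<forall>C\<in>H. v \<in> C \<and> u \<notin> C \<longrightarrow> (\<exists>C'\<in>H. C' \<subseteq> insert u (C - {v})))"

definition precedes :: "'a::linorder set set \<Rightarrow> 'a \<Rightarrow> 'a \<Rightarrow> bool" where
  "precedes H u v \<longleftrightarrow> outranks H u v \<and> (\<not> outranks H v u \<or> u < v)"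

lemma transversal_mono: "transversal H S \<Longrightarrow> S \<subseteq> S' \<Longrightarrow> transversal H S'"
  unfolding transversal_def by blast

text \<open>
  An edge missed after the swap contains \<open>v\<close> and avoids \<open>u\<close>; the edge that \<open>outranks\<close> supplies
  below its exchanged version would already have been missed before the swap.
\<close>
lemma transversal_swap:
  assumes "outranks H u v" "transversal H (insert v S)" "v \<notin> S" "u \<notin> S"
  shows "transversal H (insert u S)"
proof (rule ccontr)
  assume "\<not> transversal H (insert u S)"
  then obtain C where C: "C \<in> H" "C \<inter> insert u S = {}"
    unfolding transversal_def by blast
  then have "v \<in> C" "u \<notin> C"
    using assms(2) unfolding transversal_def by blast+
  then obtain C' where "C' \<in> H" "C' \<subseteq> insert u (C - {v})"
    using assms(1) C(1) unfolding outranks_def by blast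
  then have "C' \<inter> insert v S = {} \<or> u = v"
    using C(2) assms(3,4) by blast
  with \<open>C' \<in> H\<close> show False
    using assms(2) \<open>v \<in> C\<close> \<open>u \<notin> C\<close> unfolding transversal_def by blast
qed

lemma outranks_refl: "outranks H u u"
  unfolding outranks_def by blast

text \<open>
  The converse of \<open>transversal_swap\<close>. For an edge \<open>C\<close> through \<open>v\<close> that avoids \<open>u\<close>, the largest
  set \<open>S\<close> avoiding \<open>u\<close> for which \<open>insert u S\<close> misses \<open>C\<close> is the complement of \<open>insert u C\<close>. As then \<open>insert v S\<close>
  is no transversal either, some edge lies in its complement \<open>insert u (C - {v})\<close>.
\<close>
lemma outranksI:
  assumes edges: "\<Union>H \<subseteq> V" and "u \<in> V" "v \<in> V"
    and swap: "\<And>S. S \<subseteq> V - {u, v} \<Longrightarrow> transversal H (insert v S) \<Longrightarrow> transversal H (insert u S)"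
  shows "outranks H u v"
  unfolding outranks_def
proof (intro ballI impI)
  fix C assume C: "C \<in> H" "v \<in> C \<and> u \<notin> C"
  let ?S = "V - insert u C"
  have "insert u ?S \<inter> C = {}"
    using C by blast
  then have "\<not> transversal H (insert u ?S)"
    using C(1) unfolding transversal_def by blast
  then have "\<not> transversal H (insert v ?S)"
    using swap[of ?S] C(2) by blast
  then obtain C' where C': "C' \<in> H" "C' \<inter> insert v ?S = {}"
    unfolding transversal_def by blast
  then have "C' \<subseteq> insert u (C - {v})"
    using edges by blast
  with C'(1) show "\<exists>C'\<in>H. C' \<subseteq> insert u (C - {v})"
    by blast
qed

text \<open>
  Edges are awkward to compose, so transitivity is shown for swaps. If \<open>b\<close> is
  already present, it is first replaced by \<open>a\<close>, which makes room for \<open>b\<close> to replace \<open>c\<close>.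
\<close>
lemma outranks_trans:
  assumes "\<Union>H \<subseteq> V" "a \<in> V" "c \<in> V"
    and ab: "outranks H a b" and bc: "outranks H b c"
  shows "outranks H a c"
proof (cases "a = b \<or> b = c \<or> a = c")
  case True
  then show ?thesis using ab bc outranks_refl by metis
next
  case False
  show ?thesis
  proof (rule outranksI[OF assms(1-3)])
    fix S assume S: "S \<subseteq> V - {a, c}" and T: "transversal H (insert c S)"
    show "transversal H (insert a S)"
    proof (cases "b \<in> S")
      case True
      let ?S = "S - {b}"
      have "insert b (insert c ?S) = insert c S" "insert b (insert a ?S) = insert a S"
        using True by auto
      note eq = this
      have "transversal H (insert b (insert c ?S))"
        using T eq by simp
      then have "transversal H (insert a (insert c ?S))"
        by (rule transversal_swap[OF ab]) (use S False in auto)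
      then have "transversal H (insert c (insert a ?S))"
        by (simp add: insert_commute)
      then have "transversal H (insert b (insert a ?S))"
        by (rule transversal_swap[OF bc]) (use S False in auto)
      then show ?thesis
        using eq by simp
    next
      case b: False
      have "transversal H (insert b S)"
        by (rule transversal_swap[OF bc T]) (use S b in auto)
      then show ?thesis
        by (rule transversal_swap[OF ab]) (use S b in auto)
    qed
  qed
qed

text \<open>
  Elements of \<open>D\<close> outside \<open>B\<close> are swapped one at a time for elements of \<open>B - D\<close>, of which there are
  enough because \<open>B\<close> is at least as large, until \<open>D\<close> has become a subset of \<open>B\<close>.
\<close>
lemma transversal_exchange:
  assumes "finite B" "finite D" "transversal H D" "card D \<le> card B"
    and "\<And>b d. b \<in> B \<Longrightarrow> d \<in> D - B \<Longrightarrow> outranks H b d"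
  shows "transversal H B"
  using assms(2-)
proof (induction "card (D - B)" arbitrary: D)
  case 0
  then have "D \<subseteq> B" by auto
  with 0 show ?case using transversal_mono by blast
next
  case (Suc k)
  then obtain d where d: "d \<in> D - B"
    by (metis card.empty ex_in_conv nat.simps(3))
  have "\<not> B \<subseteq> D"
    using Suc.prems(1,3) d by (metis DiffE card_seteq)
  then obtain b where b: "b \<in> B - D" by blast
  let ?D = "insert b (D - {d})"
  have "transversal H (insert d (D - {d}))"
    using Suc.prems(2) d by (simp add: insert_absorb)
  then have "transversal H ?D"
    by (rule transversal_swap[rotated]) (use b d Suc.prems(4) in auto)
  moreover have "?D - B = (D - B) - {d}"
    using b by auto
  then have "k = card (?D - B)"
    using Suc.hyps(2) d Suc.prems(1) by simp
  moreover have "card ?D = card D"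
    using b d Suc.prems(1) by (simp add: card.insert_remove) (metis One_nat_def Suc_pred card_gt_0_iff empty_iff)
  moreover have "outranks H b' d'" if "b' \<in> B" "d' \<in> ?D - B" for b' d'
    using Suc.prems(4) that b by blast
  ultimately show ?case
    using Suc.hyps(1)[of ?D] Suc.prems(1,3) by simp
qed

text \<open>
  In a finite strict linear order the number of predecessors is the rank, and every rank occurs
  exactly once. This turns counting vertices into counting initial segments by their size.
\<close>
lemma bij_betw_card_predecessors:
  fixes V :: "'a set"
  assumes "finite V"
    and irrefl: "\<And>u. u \<in> V \<Longrightarrow> \<not> R u u"
    and trans: "\<And>a b c. a \<in> V \<Longrightarrow> b \<in> V \<Longrightarrow> c \<in> V \<Longrightarrow> R a b \<Longrightarrow> R b c \<Longrightarrow> R a c"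
    and total: "\<And>a b. a \<in> V \<Longrightarrow> b \<in> V \<Longrightarrow> a \<noteq> b \<Longrightarrow> R a b \<or> R b a"
  shows "bij_betw (\<lambda>u. card {v\<in>V. R v u}) V {..<card V}"
proof -
  let ?r = "\<lambda>u. card {v\<in>V. R v u}"
  have less: "?r a < ?r b" if "a \<in> V" "b \<in> V" "R a b" for a b
  proof (rule psubset_card_mono)
    have "{v \<in> V. R v a} \<subseteq> {v \<in> V. R v b}"
      using trans[OF _ that(1,2) _ that(3)] by auto
    then show "{v \<in> V. R v a} \<subset> {v \<in> V. R v b}"
      using irrefl[OF that(1)] that by auto
  qed (simp add: assms(1))
  have "inj_on ?r V"
  proof (rule inj_onI, rule ccontr)
    fix a b assume "a \<in> V" "b \<in> V" "?r a = ?r b" "a \<noteq> b"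
    then show False using less[of a b] less[of b a] total[of a b] by auto
  qed
  moreover have "?r ` V \<subseteq> {..<card V}"
  proof
    fix k assume "k \<in> ?r ` V"
    then obtain u where "u \<in> V" "k = ?r u" by auto
    moreover have "{v\<in>V. R v u} \<subset> V"
      using irrefl[OF \<open>u \<in> V\<close>] \<open>u \<in> V\<close> by auto
    ultimately show "k \<in> {..<card V}"
      using psubset_card_mono[OF assms(1)] by auto
  qed
  ultimately show ?thesis
    by (simp add: bij_betw_def card_image card_subset_eq)
qed

text \<open>
  The weights enter only through the totality of \<open>outranks\<close>. With \<open>\<tau>\<close> the minimum, the set of
  predecessors of \<open>u\<close> is a transversal iff it has at least \<open>\<tau>\<close> elements, by exchange with a
  minimum transversal; so the vertices counted are those of rank \<open>0, \<dots>, \<tau> - 1\<close>.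
\<close>
theorem minimum_transversal_threshold:
  fixes V :: "'a::linorder set" and w :: "'a \<Rightarrow> real"
  assumes fin: "finite V" and edges: "\<Union>H \<subseteq> V" "{} \<notin> H"
    and threshold: "\<And>S. S \<subseteq> V \<Longrightarrow> t \<le> sum w S \<longleftrightarrow> transversal H S"
  shows "(LEAST k. \<exists>S\<subseteq>V. transversal H S \<and> card S = k) =
    card {u\<in>V. \<not> transversal H {v\<in>V. precedes H v u}}" (is "(LEAST k. ?P k) = _")
proof -
  define \<tau> where "\<tau> = (LEAST k. ?P k)"
  have by_weight: "outranks H u v" if "u \<in> V" "v \<in> V" "w v \<le> w u" for u v
  proof (rule outranksI[OF edges(1) that(1,2)])
    fix S assume S: "S \<subseteq> V - {u, v}" and "transversal H (insert v S)"
    then have "t \<le> sum w (insert v S)"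
      using threshold[of "insert v S"] that by auto
    also have "\<dots> \<le> sum w (insert u S)"
      using S that finite_subset[OF _ fin, of S] by (subst (1 2) sum.insert) auto
    finally show "transversal H (insert u S)"
      using threshold[of "insert u S"] S that by auto
  qed
  have comparable: "outranks H u v \<or> outranks H v u" if "u \<in> V" "v \<in> V" for u v
    using by_weight that by (meson linear)
  note trans = outranks_trans[OF edges(1)]
  let ?B = "\<lambda>u. {v\<in>V. precedes H v u}"
  have bij: "bij_betw (\<lambda>u. card (?B u)) V {..<card V}"
  proof (rule bij_betw_card_predecessors[OF fin])
    show "precedes H a c" if "a \<in> V" "b \<in> V" "c \<in> V" "precedes H a b" "precedes H b c" for a b c
      using that trans[of a c b] trans[of c b a] trans[of b a c]
      unfolding precedes_def by (meson less_trans)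
    show "precedes H a b \<or> precedes H b a" if "a \<in> V" "b \<in> V" "a \<noteq> b" for a b
      using comparable[OF that(1,2)] that(3) unfolding precedes_def by auto
  qed (simp add: precedes_def)
  have "transversal H V"
    unfolding transversal_def
  proof
    fix C assume "C \<in> H"
    then have "C \<subseteq> V" "C \<noteq> {}" using edges by auto
    then show "C \<inter> V \<noteq> {}" by auto
  qed
  then have ex: "?P (card V)" by blast
  then have le: "\<tau> \<le> card V" unfolding \<tau>_def by (rule Least_le[of ?P])
  have "?P \<tau>"
    unfolding \<tau>_def using ex by (rule LeastI[of ?P])
  then obtain D where D: "D \<subseteq> V" "transversal H D" "card D = \<tau>"
    by (elim exE conjE)
  have iff: "\<not> transversal H (?B u) \<longleftrightarrow> card (?B u) < \<tau>" if u: "u \<in> V" for u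
  proof
    assume less: "card (?B u) < \<tau>"
    show "\<not> transversal H (?B u)"
    proof
      assume "transversal H (?B u)"
      then have "?P (card (?B u))"
        by (intro exI[of _ "?B u"]) simp
      then have "\<tau> \<le> card (?B u)"
        unfolding \<tau>_def by (rule Least_le[of ?P])
      with less show False by simp
    qed
  next
    assume nontrans: "\<not> transversal H (?B u)"
    show "card (?B u) < \<tau>"
    proof (rule ccontr)
      assume "\<not> card (?B u) < \<tau>"
      then have "card D \<le> card (?B u)" using D(3) by simp
      \<comment> \<open>As \<open>b\<close> precedes \<open>u\<close> and \<open>d\<close> does not, \<open>u\<close> lies between them.\<close>
      moreover have "outranks H b d" if "b \<in> ?B u" "d \<in> D - ?B u" for b d
      proof -
        have bd: "b \<in> V" "d \<in> V" "precedes H b u" "\<not> precedes H d u"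
          using that D(1) by auto
        then have "outranks H u d"
          using comparable[of u d] u unfolding precedes_def by blast
        then show ?thesis
          using trans[of b d u] bd unfolding precedes_def by blast
      qed
      ultimately have "transversal H (?B u)"
        using transversal_exchange[of "?B u" D H] D(2) fin finite_subset[OF D(1) fin] by simp
      with nontrans show False ..
    qed
  qed
  have "{..<\<tau>} \<subseteq> {..<card V}"
    using le by auto
  then have image: "(\<lambda>u. card (?B u)) ` {u\<in>V. card (?B u) < \<tau>} = {..<\<tau>}"
    unfolding bij_betw_imp_surj_on[OF bij, symmetric] by auto
  have "inj_on (\<lambda>u. card (?B u)) {u\<in>V. card (?B u) < \<tau>}"
    using bij_betw_imp_inj_on[OF bij] by (rule inj_on_subset) simp
  from card_image[OF this] have "card {u\<in>V. card (?B u) < \<tau>} = \<tau>"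
    unfolding image by simp
  moreover have "{u\<in>V. \<not> transversal H (?B u)} = {u\<in>V. card (?B u) < \<tau>}"
    using iff by auto
  ultimately show ?thesis unfolding \<tau>_def by simp
qed


section \<open>Bounded sums on the random access machine\<close>

text \<open>
  A sum is bounded by a variable rather than by an arbitrary expression. All variables then stay
  below any common bound of their initial values, so that the running time is a polynomial in that
  bound alone. A product of two variables is a sum with constant summand.
\<close>
datatype 'v expr =
    Num nat
  | Var 'v
  | Plus "'v expr" "'v expr"
  | Monus "'v expr" "'v expr"
  | Input "'v expr"
  | Sum 'v 'v "'v expr"

fun expr_val :: "bool list \<Rightarrow> ('v \<Rightarrow> nat) \<Rightarrow> 'v expr \<Rightarrow> nat" where
  "expr_val x \<sigma> (Num k) = k"
| "expr_val x \<sigma> (Var i) = \<sigma> i"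
| "expr_val x \<sigma> (Plus a b) = expr_val x \<sigma> a + expr_val x \<sigma> b"
| "expr_val x \<sigma> (Monus a b) = expr_val x \<sigma> a - expr_val x \<sigma> b"
| "expr_val x \<sigma> (Input a) = input_symbol x (expr_val x \<sigma> a)"
| "expr_val x \<sigma> (Sum i k a) = (\<Sum>j<\<sigma> k. expr_val x (\<sigma>(i := j)) a)"

text \<open>
  Register \<open>d\<close> holds the number of remaining iterations, \<open>d + 1\<close> the accumulated sum, \<open>d + 2\<close> the
  summation variable and \<open>d + 3\<close> the summand computed by \<open>c\<close>, then the constant 1.
\<close>
definition sum_loop :: "nat \<Rightarrow> com \<Rightarrow> com" where
  "sum_loop d c = While d
     (Seq c (Seq (Add (d + 1) (d + 1) (d + 3)) (Seq (Const (d + 3) 1)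
       (Seq (Add (d + 2) (d + 2) (d + 3)) (Sub d d (d + 3))))))"

text \<open>
  The environment \<open>\<rho>\<close> assigns registers to variables. The invariant is a stack discipline:
  variables live below \<open>d\<close>, the result is left in \<open>d\<close>, and nothing below \<open>d\<close> is changed.
\<close>
fun compile :: "('v \<Rightarrow> nat) \<Rightarrow> nat \<Rightarrow> 'v expr \<Rightarrow> com" where
  "compile \<rho> d (Num k) = Const d k"
| "compile \<rho> d (Var i) = Seq (Const d 0) (Add d d (\<rho> i))"
| "compile \<rho> d (Plus a b) = Seq (compile \<rho> d a) (Seq (compile \<rho> (d + 1) b) (Add d d (d + 1)))"
| "compile \<rho> d (Monus a b) = Seq (compile \<rho> d a) (Seq (compile \<rho> (d + 1) b) (Sub d d (d + 1)))"
| "compile \<rho> d (Input a) = Seq (compile \<rho> d a) (Read d d)"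
| "compile \<rho> d (Sum i k a) =
     Seq (Const d 0) (Seq (Add d d (\<rho> k)) (Seq (Const (d + 1) 0) (Seq (Const (d + 2) 0) (Seq
       (sum_loop d (compile (\<rho>(i := d + 2)) (d + 3) a))
       (Add d d (d + 1))))))"

text \<open>
  The indeterminate stands for a bound on the variables. An iteration of a loop takes five steps
  besides the summand, namely the test and four instructions; the final test and the five
  instructions around the loop make up the constant 6.
\<close>
fun time :: "'v expr \<Rightarrow> nat poly" where
  "time (Num k) = 1"
| "time (Var i) = 2"
| "time (Plus a b) = time a + time b + 1"
| "time (Monus a b) = time a + time b + 1"
| "time (Input a) = time a + 1"
| "time (Sum i k a) = [:0, 1:] * (time a + 5) + 6"

text \<open>
  The body may assume that the registers below \<open>d\<close> have the values they had before the loop, here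
  \<open>s0\<close>; this is where the outer variables live.
\<close>
lemma exec_sum_loop:
  assumes body: "\<And>j s. j < K \<Longrightarrow> \<forall>r<d. s r = s0 r \<Longrightarrow> s (d + 2) = j \<Longrightarrow>
      \<exists>t s'. exec x c s t s' \<and> t \<le> T \<and> s' (d + 3) = f j \<and> (\<forall>r<d + 3. s' r = s r)"
    and "\<forall>r<d. s r = s0 r" "s (d + 2) + s d = K"
  shows "\<exists>t s'. exec x (sum_loop d c) s t s' \<and> t \<le> s d * (T + 5) + 1 \<and> s' d = 0 \<and>
    s' (d + 1) = s (d + 1) + sum f {s (d + 2)..<K} \<and> (\<forall>r<d. s' r = s r)"
  using assms(2-)
proof (induction "s d" arbitrary: s)
  case 0
  then have "exec x (sum_loop d c) s 1 s"
    unfolding sum_loop_def by (intro exec.WhileFalse) simp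
  with 0 show ?case
    by (intro exI conjI) (assumption, auto)
next
  case (Suc m)
  let ?j = "s (d + 2)"
  have j: "?j < K" using Suc by simp
  obtain t s1 where s1: "exec x c s t s1" "t \<le> T" "s1 (d + 3) = f ?j" "\<forall>r<d + 3. s1 r = s r"
    using body[OF j] Suc.prems by blast
  define s2 where "s2 = s1(d + 1 := s1 (d + 1) + s1 (d + 3), d + 3 := 1,
    d + 2 := s1 (d + 2) + 1, d := s1 d - 1)"
  have regs: "s2 d = m" "s2 (d + 1) = s (d + 1) + f ?j" "s2 (d + 2) = Suc ?j" "\<forall>r<d. s2 r = s r"
    using s1 Suc.hyps(2) unfolding s2_def by auto
  have "exec x (Seq (Add (d + 1) (d + 1) (d + 3)) (Seq (Const (d + 3) 1)
      (Seq (Add (d + 2) (d + 2) (d + 3)) (Sub d d (d + 3))))) s1 (1 + (1 + (1 + 1))) s2"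
    using exec.Seq[OF exec.Add[of x "d + 1" "d + 1" "d + 3" s1]
        exec.Seq[OF exec.Const[of x "d + 3" 1]
        exec.Seq[OF exec.Add[of x "d + 2" "d + 2" "d + 3"] exec.Sub[of x d d "d + 3"]]]]
    unfolding s2_def by simp
  note step = exec.Seq[OF s1(1) this]
  obtain t' s' where s': "exec x (sum_loop d c) s2 t' s'"
      "t' \<le> m * (T + 5) + 1" "s' d = 0" "s' (d + 1) = s2 (d + 1) + sum f {s2 (d + 2)..<K}"
      "\<forall>r<d. s' r = s2 r"
    using Suc.hyps(1)[of s2] regs Suc.prems Suc.hyps(2) by auto
  have "s d \<noteq> 0" using Suc.hyps(2) by simp
  note run = exec.WhileTrue[OF this step s'(1)[unfolded sum_loop_def], folded sum_loop_def]
  have "t + (1 + (1 + (1 + 1))) + t' + 1 \<le> s d * (T + 5) + 1"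
    using s1(2) s'(2) unfolding Suc.hyps(2)[symmetric] by simp
  moreover have "s' (d + 1) = s (d + 1) + sum f {?j..<K}"
    using s'(4) regs j by (simp add: sum.atLeast_Suc_lessThan)
  ultimately show ?case
    using run s'(3,5) regs(4) by (intro exI conjI) (assumption, auto)
qed

lemma exec_compile:
  assumes "\<And>i. \<rho> i < d" "\<And>i. s (\<rho> i) = \<sigma> i" "\<And>i. \<sigma> i \<le> M"
  shows "\<exists>t s'. exec x (compile \<rho> d e) s t s' \<and> t \<le> poly (time e) M \<and> s' d = expr_val x \<sigma> e \<and>
    (\<forall>r<d. s' r = s r)"
  using assms
proof (induction e arbitrary: \<rho> d s \<sigma>)
  case (Num k)
  have "exec x (compile \<rho> d (Num k)) s 1 (s(d := k))"
    unfolding compile.simps by (rule exec.Const)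
  then show ?case
    by (intro exI conjI) (assumption, auto)
next
  case (Var i)
  have "exec x (compile \<rho> d (Var i)) s (1 + 1) (s(d := 0, d := (s(d := 0)) d + (s(d := 0)) (\<rho> i)))"
    unfolding compile.simps by (rule exec.Seq[OF exec.Const exec.Add])
  then show ?case
    using Var.prems(1)[of i] Var.prems(2)[of i] by (intro exI conjI) (assumption, auto)
next
  case (Plus a b)
  obtain t1 s1 where 1: "exec x (compile \<rho> d a) s t1 s1" "t1 \<le> poly (time a) M"
      "s1 d = expr_val x \<sigma> a" "\<forall>r<d. s1 r = s r"
    using Plus.IH(1)[of \<rho> d s \<sigma>] Plus.prems by blast
  obtain t2 s2 where 2: "exec x (compile \<rho> (d + 1) b) s1 t2 s2" "t2 \<le> poly (time b) M"
      "s2 (d + 1) = expr_val x \<sigma> b" "\<forall>r<d + 1. s2 r = s1 r"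
    using Plus.IH(2)[of \<rho> "d + 1" s1 \<sigma>] Plus.prems 1(4) less_Suc_eq by auto
  from exec.Seq[OF 1(1) exec.Seq[OF 2(1) exec.Add[of x d d "d + 1" s2]]] show ?case
    using 1(2-) 2(2-) unfolding compile.simps by (intro exI conjI) (assumption, auto)
next
  case (Monus a b)
  obtain t1 s1 where 1: "exec x (compile \<rho> d a) s t1 s1" "t1 \<le> poly (time a) M"
      "s1 d = expr_val x \<sigma> a" "\<forall>r<d. s1 r = s r"
    using Monus.IH(1)[of \<rho> d s \<sigma>] Monus.prems by blast
  obtain t2 s2 where 2: "exec x (compile \<rho> (d + 1) b) s1 t2 s2" "t2 \<le> poly (time b) M"
      "s2 (d + 1) = expr_val x \<sigma> b" "\<forall>r<d + 1. s2 r = s1 r"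
    using Monus.IH(2)[of \<rho> "d + 1" s1 \<sigma>] Monus.prems 1(4) less_Suc_eq by auto
  from exec.Seq[OF 1(1) exec.Seq[OF 2(1) exec.Sub[of x d d "d + 1" s2]]] show ?case
    using 1(2-) 2(2-) unfolding compile.simps by (intro exI conjI) (assumption, auto)
next
  case (Input a)
  obtain t1 s1 where 1: "exec x (compile \<rho> d a) s t1 s1" "t1 \<le> poly (time a) M"
      "s1 d = expr_val x \<sigma> a" "\<forall>r<d. s1 r = s r"
    using Input.IH[of \<rho> d s \<sigma>] Input.prems by blast
  from exec.Seq[OF 1(1) exec.Read[of x d d s1]] show ?case
    using 1(2-) unfolding compile.simps by (intro exI conjI) (assumption, auto)
next
  case (Sum i k a)
  let ?f = "\<lambda>j. expr_val x (\<sigma>(i := j)) a"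
  define s0 where "s0 = s(d := \<sigma> k, d + 1 := 0, d + 2 := 0)"
  have body: "\<exists>t s'. exec x (compile (\<rho>(i := d + 2)) (d + 3) a) s1 t s' \<and> t \<le> poly (time a) M \<and>
      s' (d + 3) = ?f j \<and> (\<forall>r<d + 3. s' r = s1 r)"
    if "j < \<sigma> k" "\<forall>r<d. s1 r = s r" "s1 (d + 2) = j" for j s1
  proof (rule Sum.IH)
    show "(\<rho>(i := d + 2)) l < d + 3" for l
      using Sum.prems(1)[of l] by simp
    show "s1 ((\<rho>(i := d + 2)) l) = (\<sigma>(i := j)) l" for l
      using that Sum.prems(1,2)[of l] by simp
    show "(\<sigma>(i := j)) l \<le> M" for l
      using that(1) Sum.prems(3)[of l] Sum.prems(3)[of k] by simp
  qed
  have "\<forall>r<d. s0 r = s r" "s0 (d + 2) + s0 d = \<sigma> k"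
    unfolding s0_def by auto
  from exec_sum_loop[where f = ?f, OF body this]
  obtain t1 s1 where 1: "exec x (sum_loop d (compile (\<rho>(i := d + 2)) (d + 3) a)) s0 t1 s1"
     "t1 \<le> s0 d * (poly (time a) M + 5) + 1" "s1 d = 0"
     "s1 (d + 1) = s0 (d + 1) + sum ?f {s0 (d + 2)..<\<sigma> k}" "\<forall>r<d. s1 r = s0 r"
    by blast
  have Add: "exec x (Add d d (\<rho> k)) (s(d := 0)) 1 (s(d := \<sigma> k))"
    using exec.Add[of x d d "\<rho> k" "s(d := 0)"] Sum.prems(1,2)[of k] by simp
  have Const: "exec x (Const (d + 2) 0) (s(d := \<sigma> k, d + 1 := 0)) 1 s0"
    unfolding s0_def by (rule exec.Const)
  note run = exec.Seq[OF exec.Const exec.Seq[OF Add exec.Seq[OF exec.Const exec.Seq[OF Const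
    exec.Seq[OF 1(1) exec.Add[of x d d "d + 1" s1]]]]]]
  have "s0 d * (poly (time a) M + 5) \<le> M * (poly (time a) M + 5)"
    using Sum.prems(3)[of k] unfolding s0_def by (intro mult_right_mono) auto
  with 1(2) have "t1 \<le> M * (poly (time a) M + 5) + 1"
    by linarith
  then have "1 + (1 + (1 + (1 + (t1 + 1)))) \<le> poly (time (Sum i k a)) M"
    by simp
  moreover have "s1 d + s1 (d + 1) = expr_val x \<sigma> (Sum i k a)"
    using 1(3,4) by (simp add: s0_def atLeast0LessThan)
  ultimately show ?case
    using run 1(5) unfolding compile.simps
    by (intro exI conjI) (assumption, auto simp: s0_def)
qed

lemma poly_mono_nat:
  fixes p :: "nat poly"
  assumes "m \<le> n"
  shows "poly p m \<le> poly p n"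
  using assms by (induction p) (auto intro!: add_mono mult_mono)


section \<open>The total domination number as a bounded sum\<close>

text \<open>
  An expression is read as a truth value by being nonzero. Addition is then disjunction and a sum is
  an existential quantifier. Negation returns 0 or 1, so that a doubly negated condition can be counted.
\<close>
definition negation :: "'v expr \<Rightarrow> 'v expr" where
  "negation a = Monus (Num 1) a"

definition conjunction :: "'v expr \<Rightarrow> 'v expr \<Rightarrow> 'v expr" where
  "conjunction a b = negation (Plus (negation a) (negation b))"

definition unequal :: "'v \<Rightarrow> 'v \<Rightarrow> 'v expr" where
  "unequal i j = Plus (Monus (Var i) (Var j)) (Monus (Var j) (Var i))"

abbreviation holds :: "bool list \<Rightarrow> ('v \<Rightarrow> nat) \<Rightarrow> 'v expr \<Rightarrow> bool" where
  "holds x \<sigma> a \<equiv> 0 < expr_val x \<sigma> a"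

lemma expr_val_negation: "expr_val x \<sigma> (negation a) = of_bool (\<not> holds x \<sigma> a)"
  by (simp add: negation_def)

lemma holds_conjunction: "holds x \<sigma> (conjunction a b) \<longleftrightarrow> holds x \<sigma> a \<and> holds x \<sigma> b"
  by (simp add: conjunction_def expr_val_negation)

lemma holds_unequal: "holds x \<sigma> (unequal i j) \<longleftrightarrow> \<sigma> i \<noteq> \<sigma> j"
  by (auto simp: unequal_def)

lemma holds_Plus: "holds x \<sigma> (Plus a b) \<longleftrightarrow> holds x \<sigma> a \<or> holds x \<sigma> b"
  by simp

lemma holds_Sum: "holds x \<sigma> (Sum i k a) \<longleftrightarrow> (\<exists>j<\<sigma> k. holds x (\<sigma>(i := j)) a)"
  by (auto simp: neq0_conv[symmetric] simp del: neq0_conv)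

text \<open>
  \<open>Order\<close> is the number of vertices and \<open>Aux\<close> serves to multiply; the variables \<open>Z\<close>, \<open>E\<close> and \<open>E'\<close>
  range over indices of edges, the others over vertices. \<open>U\<close> and \<open>V\<close> are never bound inside a
  comparison, so a comparison may be instantiated with them in either order without capture.
\<close>
datatype var = Order | Aux | U | V | Z | E | E' | Y

text \<open>The adjacency matrix starts after \<open>n\<close> unary digits and a separator.\<close>
definition arc :: "var \<Rightarrow> var \<Rightarrow> var expr" where
  "arc z v = Input (Plus (Plus (Var Order) (Num 1)) (Plus (Sum Aux z (Var Order)) (Var v)))"

definition outranks_expr :: "var \<Rightarrow> var \<Rightarrow> var expr" where
  "outranks_expr u v =
     negation (Sum E Order (conjunction (conjunction (arc E v) (negation (arc E u)))
       (negation (Sum E' Order (negation (Sum Y Order (conjunction (arc E' Y) (conjunction (unequal Y u)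
          (Plus (negation (unequal Y v)) (negation (arc E Y)))))))))))"

definition precedes_expr :: "var \<Rightarrow> var \<Rightarrow> var expr" where
  "precedes_expr u v =
     conjunction (outranks_expr u v) (Plus (negation (outranks_expr v u)) (Monus (Var v) (Var u)))"

definition gamma_expr :: "var expr" where
  "gamma_expr =
     Sum U Order (negation (negation (Sum Z Order (negation (Sum V Order (conjunction (arc Z V) (precedes_expr V U)))))))"

text \<open>For an adjacency matrix \<open>A\<close> this is the neighbourhood hypergraph.\<close>
definition row_hypergraph :: "nat \<Rightarrow> (nat \<Rightarrow> nat \<Rightarrow> bool) \<Rightarrow> nat set set" where
  "row_hypergraph n A = (\<lambda>i. {j. j < n \<and> A i j}) ` {..<n}"

lemma outranks_row_hypergraph:
  assumes "a < n" "b < n"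
  shows "outranks (row_hypergraph n A) a b \<longleftrightarrow>
    \<not> (\<exists>i<n. (A i b \<and> \<not> A i a) \<and>
      \<not> (\<exists>j<n. \<not> (\<exists>y<n. A j y \<and> y \<noteq> a \<and> (y = b \<or> \<not> A i y))))"
proof -
  define Q where "Q i j \<longleftrightarrow> \<not> (\<exists>y<n. A j y \<and> y \<noteq> a \<and> (y = b \<or> \<not> A i y))" for i j
  have sub: "{y. y < n \<and> A j y} \<subseteq> insert a ({y. y < n \<and> A i y} - {b}) \<longleftrightarrow> Q i j" for i j
    unfolding Q_def by auto
  have "outranks (row_hypergraph n A) a b \<longleftrightarrow>
    (\<forall>i\<in>{..<n}. b \<in> {y. y < n \<and> A i y} \<and> a \<notin> {y. y < n \<and> A i y} \<longrightarrow> (\<exists>j\<in>{..<n}. Q i j))"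
    unfolding outranks_def row_hypergraph_def ball_simps bex_simps sub ..
  also have "\<dots> \<longleftrightarrow> \<not> (\<exists>i<n. (A i b \<and> \<not> A i a) \<and> \<not> (\<exists>j<n. Q i j))"
    using assms by auto
  finally show ?thesis unfolding Q_def .
qed

context
  fixes x :: "bool list" and n :: nat and A :: "nat \<Rightarrow> nat \<Rightarrow> bool"
  assumes matrix: "\<And>i j. i < n \<Longrightarrow> j < n \<Longrightarrow> input_symbol x (n + 1 + (i * n + j)) = of_bool (A i j)"
begin

lemma expr_val_arc:
  assumes "\<sigma> Order = n" "\<sigma> z < n" "\<sigma> v < n"
  shows "expr_val x \<sigma> (arc z v) = of_bool (A (\<sigma> z) (\<sigma> v))"
  using matrix[OF assms(2,3)] assms(1) by (simp add: arc_def)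

lemma holds_outranks_expr:
  assumes "\<sigma> Order = n" "\<sigma> u < n" "\<sigma> v < n" "u \<in> {U, V}" "v \<in> {U, V}"
  shows "holds x \<sigma> (outranks_expr u v) \<longleftrightarrow> outranks (row_hypergraph n A) (\<sigma> u) (\<sigma> v)"
proof -
  have fresh: "u \<noteq> E" "u \<noteq> E'" "u \<noteq> Y" "v \<noteq> E" "v \<noteq> E'" "v \<noteq> Y"
    using assms(4,5) by auto
  have "holds x \<sigma> (outranks_expr u v) \<longleftrightarrow>
    \<not> (\<exists>i<n. (A i (\<sigma> v) \<and> \<not> A i (\<sigma> u)) \<and>
      \<not> (\<exists>j<n. \<not> (\<exists>y<n. A j y \<and> y \<noteq> \<sigma> u \<and> (y = \<sigma> v \<or> \<not> A i y))))"
    using assms(1-3) fresh unfolding outranks_expr_def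
    by (simp add: expr_val_negation holds_conjunction holds_unequal holds_Sum holds_Plus expr_val_arc
      del: expr_val.simps cong: conj_cong)
  also have "\<dots> \<longleftrightarrow> outranks (row_hypergraph n A) (\<sigma> u) (\<sigma> v)"
    unfolding outranks_row_hypergraph[OF assms(2,3)] ..
  finally show ?thesis .
qed

lemma holds_precedes_expr:
  assumes "\<sigma> Order = n" "\<sigma> u < n" "\<sigma> v < n" "u \<in> {U, V}" "v \<in> {U, V}"
  shows "holds x \<sigma> (precedes_expr u v) \<longleftrightarrow> precedes (row_hypergraph n A) (\<sigma> u) (\<sigma> v)"
  using holds_outranks_expr[OF assms] holds_outranks_expr[OF assms(1,3,2,5,4)]
  unfolding precedes_expr_def precedes_def holds_conjunction holds_Plus expr_val_negation by simp

lemma expr_val_gamma_expr: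
  "expr_val x (\<lambda>_. n) gamma_expr =
     card {u\<in>{..<n}. \<not> transversal (row_hypergraph n A) {v\<in>{..<n}. precedes (row_hypergraph n A) v u}}"
proof -
  have "holds x ((\<lambda>_. n)(U := u)) (Sum Z Order (negation (Sum V Order (conjunction (arc Z V) (precedes_expr V U)))))
    \<longleftrightarrow> \<not> transversal (row_hypergraph n A) {v\<in>{..<n}. precedes (row_hypergraph n A) v u}"
    (is "?l \<longleftrightarrow> ?r") if "u < n" for u
  proof -
    have "?l \<longleftrightarrow> (\<exists>i<n. \<not> (\<exists>v<n. A i v \<and> precedes (row_hypergraph n A) v u))"
      using that by (auto simp: expr_val_negation holds_conjunction holds_Sum expr_val_arc holds_precedes_expr
        simp del: expr_val.simps cong: conj_cong)
    also have "\<dots> \<longleftrightarrow> ?r"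
      unfolding transversal_def by (auto simp: row_hypergraph_def)
    finally show ?thesis .
  qed
  then have "expr_val x (\<lambda>_. n) gamma_expr = (\<Sum>u<n. of_bool (\<not> transversal (row_hypergraph n A)
      {v\<in>{..<n}. precedes (row_hypergraph n A) v u}))"
    unfolding gamma_expr_def by (subst expr_val.simps) (simp add: expr_val_negation del: expr_val.simps)
  also have "\<dots> = card ({..<n} \<inter> {u. \<not> transversal (row_hypergraph n A)
      {v\<in>{..<n}. precedes (row_hypergraph n A) v u}})"
    by (subst sum_of_bool_eq) auto
  also have "{..<n} \<inter> {u. \<not> transversal (row_hypergraph n A)
      {v\<in>{..<n}. precedes (row_hypergraph n A) v u}} =
    {u\<in>{..<n}. \<not> transversal (row_hypergraph n A) {v\<in>{..<n}. precedes (row_hypergraph n A) v u}}"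
    by blast
  finally show ?thesis .
qed

end

definition adjacent :: "'a pair_pre_digraph \<Rightarrow> 'a list \<Rightarrow> nat \<Rightarrow> nat \<Rightarrow> bool" where
  "adjacent G vs i j \<longleftrightarrow> (vs ! i, vs ! j) \<in> parcs G"

lemma pverts_eq_image_nth:
  assumes "vertex_enumeration G vs"
  shows "pverts G = (!) vs ` {..<length vs}"
  using assms unfolding vertex_enumeration_def
  by (metis atLeast0LessThan list.set_map map_nth set_upt)

lemma total_dominating_set_image:
  assumes "vertex_enumeration G vs" "S \<subseteq> {..<length vs}"
  shows "total_dominating_set G ((!) vs ` S) \<longleftrightarrow>
    transversal (row_hypergraph (length vs) (adjacent G vs)) S"
proof -
  note verts = pverts_eq_image_nth[OF assms(1)]
  have "(!) vs ` S \<subseteq> pverts G"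
    using assms(2) unfolding verts by blast
  then have "total_dominating_set G ((!) vs ` S) \<longleftrightarrow>
      (\<forall>i<length vs. \<exists>j\<in>S. adjacent G vs i j)"
    unfolding total_dominating_set_def adjacent_def verts by auto
  also have "\<dots> \<longleftrightarrow> transversal (row_hypergraph (length vs) (adjacent G vs)) S"
    using assms(2) unfolding transversal_def row_hypergraph_def by fastforce
  finally show ?thesis .
qed

lemma total_domination_number_eq_transversal:
  assumes "vertex_enumeration G vs"
  shows "total_domination_number G =
    (LEAST k. \<exists>S\<subseteq>{..<length vs}. transversal (row_hypergraph (length vs) (adjacent G vs)) S \<and> card S = k)"
proof -
  have inj: "inj_on ((!) vs) {..<length vs}"
    using assms by (simp add: vertex_enumeration_def inj_on_nth)
  note verts = pverts_eq_image_nth[OF assms(1)]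
  have "(\<exists>D. total_dominating_set G D \<and> card D = k) \<longleftrightarrow>
    (\<exists>S\<subseteq>{..<length vs}. transversal (row_hypergraph (length vs) (adjacent G vs)) S \<and> card S = k)" for k
  proof
    assume "\<exists>D. total_dominating_set G D \<and> card D = k"
    then obtain D where D: "total_dominating_set G D" "card D = k" by blast
    then have "D \<subseteq> (!) vs ` {..<length vs}"
      unfolding total_dominating_set_def verts by blast
    then obtain S where S: "S \<subseteq> {..<length vs}" "D = (!) vs ` S"
      by (rule subset_imageE)
    then show "\<exists>S\<subseteq>{..<length vs}. transversal (row_hypergraph (length vs) (adjacent G vs)) S \<and> card S = k"
      using D total_dominating_set_image[OF assms S(1)] card_image[OF inj_on_subset[OF inj S(1)]] by auto
  next
    assume "\<exists>S\<subseteq>{..<length vs}. transversal (row_hypergraph (length vs) (adjacent G vs)) S \<and> card S = k"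
    then obtain S where S: "S \<subseteq> {..<length vs}"
      "transversal (row_hypergraph (length vs) (adjacent G vs)) S" "card S = k" by blast
    then show "\<exists>D. total_dominating_set G D \<and> card D = k"
      using total_dominating_set_image[OF assms S(1)] card_image[OF inj_on_subset[OF inj S(1)]] by auto
  qed
  then show ?thesis
    unfolding total_domination_number_def by simp
qed

text \<open>
  The weights of the vertices are carried over to their positions in the enumeration. Without
  isolated vertices no neighbourhood is empty, so the hypergraph has a transversal at all.
\<close>
lemma total_domination_number_domishold:
  fixes G :: "'a pair_pre_digraph"
  assumes vs: "vertex_enumeration G vs" and "no_isolated_vertices G" and "total_domishold G"
  defines "n \<equiv> length vs" and "H \<equiv> row_hypergraph (length vs) (adjacent G vs)"
  shows "total_domination_number G =
    card {u\<in>{..<n}. \<not> transversal H {v\<in>{..<n}. precedes H v u}}"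
proof -
  have inj: "inj_on ((!) vs) {..<n}"
    using vs by (simp add: n_def vertex_enumeration_def inj_on_nth)
  have verts: "pverts G = (!) vs ` {..<n}"
    using pverts_eq_image_nth[OF vs] unfolding n_def .
  obtain w :: "'a \<Rightarrow> real" and t :: real where wt: "\<And>S. S \<subseteq> pverts G \<Longrightarrow> t \<le> sum w S \<longleftrightarrow> total_dominating_set G S"
    using assms(3) unfolding total_domishold_def by blast
  have "t \<le> sum (w \<circ> (!) vs) S \<longleftrightarrow> transversal H S" if S: "S \<subseteq> {..<n}" for S
  proof -
    have "(!) vs ` S \<subseteq> pverts G"
      using S unfolding verts by blast
    then have "t \<le> sum w ((!) vs ` S) \<longleftrightarrow> transversal H S"
      using wt total_dominating_set_image[OF vs] S unfolding n_def H_def by blast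
    then show ?thesis
      using sum.reindex[OF inj_on_subset[OF inj S], of w] by simp
  qed
  moreover have "\<Union>H \<subseteq> {..<n}"
    unfolding H_def n_def row_hypergraph_def by auto
  moreover have "{} \<notin> H"
  proof
    assume "{} \<in> H"
    then obtain i where "i < n" "\<And>j. j < n \<Longrightarrow> (vs ! i, vs ! j) \<notin> parcs G"
      unfolding H_def n_def row_hypergraph_def adjacent_def by auto
    then show False
      using assms(2) unfolding no_isolated_vertices_def verts by auto
  qed
  ultimately show ?thesis
    using minimum_transversal_threshold[of "{..<n}" H t "w \<circ> (!) vs"]
      total_domination_number_eq_transversal[OF vs]
    unfolding n_def H_def by simp
qed


section \<open>Reading the encoding\<close>

lemma nth_concat_matrix:
  assumes "i < length xs" "j < length ys"
  shows "i * length ys + j < length (concat (map (\<lambda>u. map (f u) ys) xs)) \<and>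
    concat (map (\<lambda>u. map (f u) ys) xs) ! (i * length ys + j) = f (xs ! i) (ys ! j)"
  using assms
proof (induction xs arbitrary: i)
  case (Cons a xs)
  then show ?case by (cases i) (auto simp: nth_append add.assoc)
qed simp

lemma input_symbol_graph_code:
  assumes "i < length vs" "j < length vs"
  shows "input_symbol (graph_code G vs) (length vs + 1 + (i * length vs + j)) =
    of_bool (adjacent G vs i j)"
  using nth_concat_matrix[OF assms, of "\<lambda>u v. (u, v) \<in> parcs G"]
  unfolding input_symbol_def graph_code_def adjacent_def by (auto simp: nth_append)

lemma input_symbol_graph_code_prefix:
  "j < length vs \<Longrightarrow> input_symbol (graph_code G vs) j = 1"
  "input_symbol (graph_code G vs) (length vs) = 0"
  by (auto simp: input_symbol_def graph_code_def nth_append)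

text \<open>
  Register 1 is both the position of the head and the number of digits passed; register 2 holds the
  symbol at that position, which becomes zero at the separator, and serves as the constant 1
  between two readings.
\<close>
definition read_unary_loop :: com where
  "read_unary_loop = While 2 (Seq (Const 2 1) (Seq (Add 1 1 2) (Read 2 1)))"

lemma exec_read_unary_loop:
  assumes "\<And>j. j < n \<Longrightarrow> input_symbol x j = 1" "input_symbol x n = 0"
    and "s 1 + m = n" "s 2 = input_symbol x (s 1)"
  shows "\<exists>t s'. exec x read_unary_loop s t s' \<and> t \<le> 4 * m + 1 \<and> s' 0 = s 0 \<and> s' 1 = n"
  using assms(3-)
proof (induction m arbitrary: s)
  case 0
  then have "exec x read_unary_loop s 1 s"
    unfolding read_unary_loop_def using assms(2) by (intro exec.WhileFalse) simp
  with 0 show ?case by (intro exI conjI) (assumption, auto)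
next
  case (Suc m)
  define s1 where "s1 = s(1 := s 1 + 1, 2 := input_symbol x (s 1 + 1))"
  have "exec x (Seq (Const 2 1) (Seq (Add 1 1 2) (Read 2 1))) s (1 + (1 + 1)) s1"
    using exec.Seq[OF exec.Const[of x 2 1 s] exec.Seq[OF exec.Add[of x 1 1 2] exec.Read[of x 2 1]]]
    unfolding s1_def by (simp add: fun_upd_twist)
  moreover have "s1 1 + m = n" "s1 2 = input_symbol x (s1 1)"
    using Suc.prems(1) unfolding s1_def by simp_all
  from Suc.IH[OF this] obtain t s' where s': "exec x read_unary_loop s1 t s'" "t \<le> 4 * m + 1"
      "s' 0 = s1 0" "s' 1 = n"
    by blast
  moreover have "s 2 \<noteq> 0"
    using Suc.prems assms(1)[of "s 1"] by simp
  ultimately have "exec x read_unary_loop s (1 + (1 + 1) + t + 1) s'"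
    unfolding read_unary_loop_def by (intro exec.WhileTrue)
  then show ?case
    using s' by (intro exI conjI) (assumption, auto simp: s1_def)
qed

text \<open>
  Registers 0 and 1 lie below the stack of the compiled expression: register 1 keeps the number
  of vertices, and register 0, still zero, receives the result. Every variable initially denotes
  the number of vertices, which is the common bound needed for the running time.
\<close>
theorem proposition6p3:
  shows "poly_time_computable
    {(G :: nat pair_pre_digraph, vs). pair_graph G \<and> vertex_enumeration G vs \<and>
       no_isolated_vertices G \<and> total_domishold G}
    (\<lambda>(G, vs). graph_code G vs)
    (\<lambda>(G, vs). total_domination_number G)"
proof -
  define c where
    "c = Seq (Read 2 1) (Seq read_unary_loop (Seq (compile (\<lambda>_. 1) 2 gamma_expr) (Add 0 0 2)))"
  \<comment> \<open>Scanning the prefix takes at most \<open>4 * n + 1\<close> steps; one more step precedes it, and one ends the program.\<close>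
  define p where "p = time gamma_expr + [:3, 4:]"
  have "\<exists>t s. exec (graph_code G vs) c (\<lambda>_. 0) t s \<and> t \<le> poly p (length (graph_code G vs)) \<and>
      s 0 = total_domination_number G"
    if G: "vertex_enumeration G vs" "no_isolated_vertices G" "total_domishold G"
    for G :: "nat pair_pre_digraph" and vs
  proof -
    let ?x = "graph_code G vs" and ?n = "length vs"
    define s0 :: "nat \<Rightarrow> nat" where "s0 = (\<lambda>_. 0)(2 := input_symbol ?x 0)"
    have 0: "exec ?x (Read 2 1) (\<lambda>_. 0) 1 s0"
      using exec.Read[of ?x 2 1 "\<lambda>_. 0"] unfolding s0_def .
    have "s0 1 + ?n = ?n" "s0 2 = input_symbol ?x (s0 1)"
      unfolding s0_def by simp_all
    from exec_read_unary_loop[OF input_symbol_graph_code_prefix this]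
    obtain t1 s1 where 1: "exec ?x read_unary_loop s0 t1 s1" "t1 \<le> 4 * ?n + 1" "s1 0 = s0 0" "s1 1 = ?n"
      by blast
    obtain t2 s2 where 2: "exec ?x (compile (\<lambda>_. 1) 2 gamma_expr) s1 t2 s2"
      "t2 \<le> poly (time gamma_expr) ?n" "s2 2 = expr_val ?x (\<lambda>_. ?n) gamma_expr" "\<forall>r<2. s2 r = s1 r"
      using exec_compile[of "\<lambda>_. 1" 2 s1 "\<lambda>_. ?n" ?n ?x gamma_expr] 1(4) by auto
    note run = exec.Seq[OF 0 exec.Seq[OF 1(1) exec.Seq[OF 2(1) exec.Add[of ?x 0 0 2 s2]]]]
    have "?n \<le> length ?x"
      by (simp add: graph_code_def)
    then have "poly p ?n \<le> poly p (length ?x)"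
      by (rule poly_mono_nat)
    moreover have "1 + (t1 + (t2 + 1)) \<le> poly p ?n"
      using 1(2) 2(2) unfolding p_def by simp
    moreover have "s2 0 + s2 2 = total_domination_number G"
      using 1(3) 2(3,4) s0_def total_domination_number_domishold[OF G]
        expr_val_gamma_expr[of ?n ?x "adjacent G vs", OF input_symbol_graph_code] by simp
    ultimately show ?thesis
      using run unfolding c_def by (intro exI conjI) (assumption, auto)
  qed
  then show ?thesis
    unfolding poly_time_computable_def by (intro exI[of _ c] exI[of _ p]) auto
qed

end
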